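(* Let $n\ge 1$, let $\eta \in \mathrm{GL}(n,\mathbf{Z})$ be a nontrivial semisimple element, and let $\Gamma<\mathrm{GL}(n,\mathbf{Z})$ be a torsion free, virtually unipotent subgroup. Then there exists a finite index subgroup $\Lambda_0$ of $\mathrm{GL}(n,\mathbf{Z})$ such that $\Gamma<\Lambda_0$ and $[\eta]\cap \Lambda_0 = \emptyset$.
   Context: $[\eta]$ denotes the $\mathrm{GL}(n,\mathbf{Z})$-conjugacy class of $\eta$. An element of $\mathrm{GL}(n,\mathbf{Z})$ is semisimple if it is diagonalizable over $\mathbf{C}$ (equivalently, the unipotent factor in its Jordan decomposition $\gamma=\gamma_s\gamma_u$ is trivial). A subgroup of $\mathrm{GL}(n,\mathbf{C})$ is unipotent if it is conjugate in $\mathrm{GL}(n,\mathbf{C})$ into the group of upper triangular matrices with ones on the diagonal, and virtually unipotent if it has a finite index unipotent subgroup. *)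

theory Defs
  imports "Jordan_Normal_Form.Matrix" "HOL-Algebra.Coset" "HOL.Complex"
begin

definition GL :: "'a::comm_ring_1 itself \<Rightarrow> nat \<Rightarrow> 'a mat monoid" where
  "GL ty n = units_of (ring_mat ty n ())"

lemma group_GL: "group (GL TYPE('a::comm_ring_1) n)"
proof -
  interpret ring "ring_mat TYPE('a) n ()" by (rule ring_mat)
  show ?thesis unfolding GL_def by (rule units_group)
qed

definition finite_index_subgroup :: "'a set \<Rightarrow> ('a, 'b) monoid_scheme \<Rightarrow> bool" where
  "finite_index_subgroup H G \<longleftrightarrow> subgroup H G \<and> finite (rcosets\<^bsub>G\<^esub> H)"

definition conjugacy_class :: "('a, 'b) monoid_scheme \<Rightarrow> 'a \<Rightarrow> 'a set" where
  "conjugacy_class G x = {g \<otimes>\<^bsub>G\<^esub> x \<otimes>\<^bsub>G\<^esub> inv\<^bsub>G\<^esub> g | g. g \<in> carrier G}"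

definition torsion_free :: "('a, 'b) monoid_scheme \<Rightarrow> bool" where
  "torsion_free G \<longleftrightarrow>
    (\<forall>x\<in>carrier G. \<forall>k::nat. k > 0 \<longrightarrow> x [^]\<^bsub>G\<^esub> k = \<one>\<^bsub>G\<^esub> \<longrightarrow> x = \<one>\<^bsub>G\<^esub>)"

abbreviation complex_mat :: "int mat \<Rightarrow> complex mat" where
  "complex_mat \<equiv> map_mat of_int"

definition semisimple :: "int mat \<Rightarrow> bool" where
  "semisimple A \<longleftrightarrow> (\<exists>D. diagonal_mat D \<and> similar_mat (complex_mat A) D)"

definition unitriangular :: "nat \<Rightarrow> 'a::comm_ring_1 mat set" where
  "unitriangular n = {A \<in> carrier_mat n n. upper_triangular A \<and> (\<forall>i<n. A $$ (i, i) = 1)}"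

definition unipotent :: "nat \<Rightarrow> complex mat set \<Rightarrow> bool" where
  "unipotent n U \<longleftrightarrow> subgroup U (GL TYPE(complex) n) \<and>
    (\<exists>P\<in>carrier (GL TYPE(complex) n). \<forall>A\<in>U.
      P \<otimes>\<^bsub>GL TYPE(complex) n\<^esub> A \<otimes>\<^bsub>GL TYPE(complex) n\<^esub> inv\<^bsub>GL TYPE(complex) n\<^esub> P
        \<in> unitriangular n)"

definition virtually_unipotent :: "nat \<Rightarrow> complex mat set \<Rightarrow> bool" where
  "virtually_unipotent n S \<longleftrightarrow> subgroup S (GL TYPE(complex) n) \<and>
    (\<exists>U. finite_index_subgroup U ((GL TYPE(complex) n)\<lparr>carrier := S\<rparr>) \<and> unipotent n U)"

end

theory Submission
  imports Defs "HOL-Number_Theory.Cong"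
begin

text \<open>Let \<open>U\<close> be a unipotent subgroup, normal in \<open>\<Gamma>\<close>, that contains \<open>\<gamma>\<^sup>N\<close> for every \<open>\<gamma> \<in> \<Gamma>\<close>.
  We take for \<open>\<Lambda>\<^sub>0\<close> the product of \<open>\<Gamma>\<close> with a principal congruence subgroup of level \<open>m\<close>.
  If a conjugate of \<open>\<eta>\<close> is congruent to \<open>\<gamma> \<in> \<Gamma>\<close> modulo \<open>m\<close>, then \<open>(\<eta>\<^sup>N - 1)\<^sup>n \<equiv> 0\<close>, hence
  \<open>(\<eta>\<^sup>N - 1)\<^sup>n = 0\<close> if \<open>m\<close> is suitably divisible, and \<open>\<eta>\<^sup>N = 1\<close> by semisimplicity. So \<open>\<gamma>\<^sup>N \<in> U\<close> is
  congruent to \<open>1\<close>, and for suitable \<open>m\<close> every such element has an \<open>N\<close>-th root \<open>w\<close> in \<open>U\<close>. Roots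
  in \<open>U\<close> are unique, so \<open>w\<close> commutes with \<open>\<gamma>\<close> and \<open>\<gamma> w\<inverse>\<close> is torsion. Hence \<open>\<gamma> = w\<close> is unipotent,
  \<open>(\<eta> - 1)\<^sup>n \<equiv> 0\<close>, and \<open>\<eta> = 1\<close> by the same argument.\<close>

section \<open>Uniform exponents: powers in finite index subgroups, torsion modulo a subgroup of a
  free abelian group\<close>

text \<open>By pigeonhole, two of the cosets of \<open>x^0, ..., x^d\<close> agree, where
  \<open>d\<close> is the index, so some \<open>x^i\<close> with \<open>0 < i \<le> d\<close> lies
  in \<open>H\<close>. The exponent \<open>i\<close> depends on \<open>x\<close>, but
  \<open>fact d\<close> is a multiple of every possible one.\<close>

lemma (in group) exists_pow_mem_finite_index:
  assumes H: "subgroup H G" and fin: "finite (rcosets H)"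
  shows "\<exists>N>0. \<forall>x\<in>carrier G. x [^] (N::nat) \<in> H"
proof (intro exI conjI ballI)
  let ?d = "card (rcosets H)"
  show "(0::nat) < fact ?d" by simp
  fix x assume x: "x \<in> carrier G"
  have "\<not> inj_on (\<lambda>i::nat. H #> x [^] i) {..?d}"
  proof
    assume "inj_on (\<lambda>i::nat. H #> x [^] i) {..?d}"
    then have "card {..?d} \<le> ?d"
      by (rule card_inj_on_le) (use fin x subgroup.subset[OF H] in \<open>auto intro!: rcosetsI\<close>)
    then show False by simp
  qed
  then obtain i j :: nat where ij: "i < j" "j \<le> ?d" "H #> x [^] i = H #> x [^] j"
    unfolding inj_on_def by (metis atMost_iff linorder_neqE_nat)
  have "x [^] j \<in> H #> x [^] i"
    using ij(3) H x rcos_self by simp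
  then have "x [^] j \<otimes> inv (x [^] i) \<in> H"
    using H x by (simp add: subgroup.rcos_module_imp is_group)
  moreover have "x [^] j = x [^] (j - i) \<otimes> x [^] i"
    using ij(1) x by (simp add: nat_pow_mult)
  ultimately have pow: "x [^] (j - i) \<in> H"
    using x by (simp add: m_assoc)
  have "(j - i) dvd fact ?d"
    using ij by (intro dvd_fact) auto
  then obtain q where q: "fact ?d = (j - i) * q" ..
  interpret H: subgroup H G by (rule H)
  have "(x [^] (j - i)) [^] q \<in> H" for q :: nat
    by (induction q) (use pow in auto)
  then show "x [^] (fact ?d :: nat) \<in> H"
    using x by (simp add: q nat_pow_pow)
qed

text \<open>The functions vanishing off \<open>S\<close> form a free abelian group of finite rank,
  so the orders of those that are torsion modulo \<open>H\<close> are bounded. The induction removes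
  one coordinate at a time.\<close>

lemma torsion_modulo_subgroup_bounded:
  fixes H :: "('i \<Rightarrow> int) set"
  assumes "finite S" and zero: "(\<lambda>_. 0) \<in> H"
    and diff: "\<And>f g. f \<in> H \<Longrightarrow> g \<in> H \<Longrightarrow> (\<lambda>i. f i - g i) \<in> H"
  shows "\<exists>e::int. e > 0 \<and> (\<forall>b. (\<forall>i. i \<notin> S \<longrightarrow> b i = 0) \<longrightarrow>
           (\<exists>k>0. (\<lambda>i. k * b i) \<in> H) \<longrightarrow> (\<lambda>i. e * b i) \<in> H)"
  using \<open>finite S\<close>
proof induction
  case empty
  have "(\<lambda>i. 1 * b i) \<in> H" if "\<forall>i. b i = 0" for b
    using zero that by simp
  then show ?case by (intro exI[of _ 1]) simp
next
  case (insert a S)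
  then obtain e :: int where e: "e > 0"
    "\<And>b k. \<forall>i. i \<notin> S \<longrightarrow> b i = 0 \<Longrightarrow> k > 0 \<Longrightarrow> (\<lambda>i. k * b i) \<in> H \<Longrightarrow> (\<lambda>i. e * b i) \<in> H"
    by blast
  have neg: "(\<lambda>i. - f i) \<in> H" if "f \<in> H" for f
    using diff[OF zero that] by simp
  have add: "(\<lambda>i. f i + g i) \<in> H" if "f \<in> H" "g \<in> H" for f g
    using diff[OF that(1) neg[OF that(2)]] by simp
  have mult: "(\<lambda>i. c * f i) \<in> H" if f: "f \<in> H" for f and c :: int
  proof (induction c rule: int_induct[of _ 0])
    case (step1 c)
    show ?case using add[OF step1(2) f] by (simp add: algebra_simps)
  next
    case (step2 c)
    show ?case using diff[OF step2(2) f] by (simp add: algebra_simps)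
  qed (use zero in simp)
  define T where "T = {b. (\<forall>i. i \<notin> insert a S \<longrightarrow> b i = 0) \<and> (\<exists>k>0. (\<lambda>i. k * b i) \<in> H)}"
  show ?case
  proof (cases "\<forall>b\<in>T. b a = 0")
    case True
    have "(\<lambda>i. e * b i) \<in> H" if "\<forall>i. i \<notin> insert a S \<longrightarrow> b i = 0" "\<exists>k>0. (\<lambda>i. k * b i) \<in> H" for b
    proof -
      have "b a = 0" using True that by (auto simp: T_def)
      then have "\<forall>i. i \<notin> S \<longrightarrow> b i = 0" using that(1) by auto
      then show ?thesis using e(2)[of b] that(2) by blast
    qed
    then show ?thesis using e(1) by blast
  next
    \<comment> \<open>The values at \<open>a\<close> of the elements of \<open>T\<close> form a
      nonzero ideal of the integers. Its least positive element \<open>d\<close> is its generator,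
      and \<open>c\<close> attains it.\<close>
    case False
    then obtain b where b: "b \<in> T" "b a \<noteq> 0" by blast
    have "(\<lambda>i. - b i) \<in> T"
      using b(1) neg[of "\<lambda>i. k * b i" for k] by (auto simp: T_def)
    then have "\<exists>b'\<in>T. b' a = int (nat \<bar>b a\<bar>)"
      using b by (cases "b a > 0") (auto intro: bexI[of _ b] bexI[of _ "\<lambda>i. - b i"])
    then have "\<exists>d::nat. d > 0 \<and> (\<exists>b\<in>T. b a = int d)"
      using b(2) by (intro exI[of _ "nat \<bar>b a\<bar>"]) simp
    then obtain d :: nat where d: "d > 0" "\<exists>b\<in>T. b a = int d"
      and least: "\<And>d'. d' < d \<Longrightarrow> \<not> (d' > 0 \<and> (\<exists>b\<in>T. b a = int d'))"
      unfolding exists_least_iff[of "\<lambda>d. d > 0 \<and> (\<exists>b\<in>T. b a = int d)"] by blast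
    then obtain c where c: "c \<in> T" "c a = int d" by blast
    then obtain k0 where k0: "k0 > 0" "(\<lambda>i. k0 * c i) \<in> H" by (auto simp: T_def)
    have "(\<lambda>i. (e * k0) * b i) \<in> H"
      if b: "\<forall>i. i \<notin> insert a S \<longrightarrow> b i = 0" "k > 0" "(\<lambda>i. k * b i) \<in> H" for b k
    proof -
      \<comment> \<open>Division with remainder: \<open>b'\<close> has the value
        \<open>b a mod d\<close> at \<open>a\<close>, which vanishes by minimality of
        \<open>d\<close>. So \<open>b'\<close> is supported on \<open>S\<close> and the induction
        hypothesis applies to it.\<close>
      define l where "l = b a div int d"
      define b' where "b' = (\<lambda>i. b i - l * c i)"
      have "(\<lambda>i. k0 * (k * b i) - (l * k) * (k0 * c i)) \<in> H"
        by (rule diff[OF mult[OF b(3)] mult[OF k0(2)]])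
      then have b'H: "(\<lambda>i. (k0 * k) * b' i) \<in> H"
        by (simp add: b'_def algebra_simps)
      then have b'T: "b' \<in> T"
        using b k0 c(1) by (auto simp: T_def b'_def intro!: exI[of _ "k0 * k"])
      have b'a: "b' a = b a mod int d"
        using c(2) by (simp add: b'_def l_def minus_div_mult_eq_mod)
      have "b' a = 0"
      proof (rule ccontr)
        assume "b' a \<noteq> 0"
        moreover have "0 \<le> b' a" "b' a < int d" using b'a d(1) by simp_all
        ultimately show False
          using least[of "nat (b' a)"] b'T by (auto simp: nat_less_iff)
      qed
      then have "(\<lambda>i. e * b' i) \<in> H"
        using b'T b'H b k0 by (intro e(2)[of b' "k0 * k"]) (auto simp: T_def)
      \<comment> \<open>Here \<open>e * k0 * b\<close> is the sum of \<open>k0 * (e * b')\<close>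
        and \<open>(l * e) * (k0 * c)\<close>, both in \<open>H\<close>.\<close>
      from add[OF mult[OF this, of k0] mult[OF k0(2), of "l * e"]]
      show ?thesis by (simp add: b'_def algebra_simps)
    qed
    then show ?thesis using e(1) k0(1) by (intro exI[of _ "e * k0"]) auto
  qed
qed

section \<open>Congruence of matrices\<close>

definition mcong :: "nat \<Rightarrow> int \<Rightarrow> int mat \<Rightarrow> int mat \<Rightarrow> bool" where
  "mcong n m A B \<longleftrightarrow> A \<in> carrier_mat n n \<and> B \<in> carrier_mat n n \<and>
     (\<forall>i<n. \<forall>j<n. [A $$ (i, j) = B $$ (i, j)] (mod m))"

lemma mcong_refl: "A \<in> carrier_mat n n \<Longrightarrow> mcong n m A A"
  by (simp add: mcong_def)

lemma mcong_sym: "mcong n m A B \<Longrightarrow> mcong n m B A"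
  by (auto simp: mcong_def cong_sym)

lemma mcong_dvd: "mcong n m A B \<Longrightarrow> k dvd m \<Longrightarrow> mcong n k A B"
  by (auto simp: mcong_def intro: cong_dvd_modulus)

lemma mcong_mult:
  assumes "mcong n m A B" "mcong n m C D"
  shows "mcong n m (A * C) (B * D)"
  using assms unfolding mcong_def
  by (auto simp: scalar_prod_def intro!: cong_sum cong_mult)

lemma mcong_diff:
  assumes "mcong n m A B" "mcong n m C D"
  shows "mcong n m (A - C) (B - D)"
  using assms unfolding mcong_def by (auto intro!: cong_diff)

lemma mcong_pow: "mcong n m A B \<Longrightarrow> mcong n m (A ^\<^sub>m k) (B ^\<^sub>m k)"
proof (induction k)
  case 0
  then show ?case by (auto simp: mcong_def)
qed (simp add: mcong_mult)

section \<open>General linear groups and congruence neighbourhoods of their subgroups\<close>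

lemma GL_simps:
  "x \<otimes>\<^bsub>GL ty n\<^esub> y = x * y" "\<one>\<^bsub>GL ty n\<^esub> = 1\<^sub>m n"
  by (simp_all add: GL_def units_of_def ring_mat_simps)

lemma GL_carrier_mat: "x \<in> carrier (GL ty n) \<Longrightarrow> x \<in> carrier_mat n n"
  by (auto simp: GL_def units_of_def Units_def ring_mat_simps)

lemma GL_pow:
  assumes "x \<in> carrier (GL ty n)"
  shows "x [^]\<^bsub>GL ty n\<^esub> (k::nat) = x ^\<^sub>m k"
  using GL_carrier_mat[OF assms] by (induction k) (auto simp: GL_simps)

text \<open>This set is the product of \<open>S\<close> with the principal congruence subgroup of
  level \<open>m\<close>. For inverses, a congruence between \<open>g\<close> and \<open>s\<close>
  is multiplied by the inverse of \<open>g\<close> on the left and that of \<open>s\<close> on the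
  right.\<close>

lemma mcong_nhd_subgroup:
  assumes S: "subgroup S (GL TYPE(int) n)"
  shows "subgroup {g \<in> carrier (GL TYPE(int) n). \<exists>s\<in>S. mcong n m g s} (GL TYPE(int) n)"
    (is "subgroup ?L ?G")
proof -
  interpret G: group ?G by (rule group_GL)
  interpret S: subgroup S ?G by (rule S)
  show ?thesis
  proof (rule G.subgroupI)
    show "?L \<noteq> {}"
      using S.one_closed S.subset mcong_refl[OF one_carrier_mat, of n m]
      by (auto simp: GL_simps intro!: exI[of _ "1\<^sub>m n"])
  next
    fix g assume "g \<in> ?L"
    then obtain s where s: "g \<in> carrier ?G" "s \<in> S" "mcong n m g s" by blast
    note sG = S.mem_carrier[OF s(2)]
    let ?g = "inv\<^bsub>?G\<^esub> g" and ?s = "inv\<^bsub>?G\<^esub> s"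
    have mat: "?g \<in> carrier_mat n n" "?s \<in> carrier_mat n n"
      using GL_carrier_mat[OF G.inv_closed[OF s(1)]] GL_carrier_mat[OF G.inv_closed[OF sG]] .
    have "mcong n m (?g * s * ?s) (?g * g * ?s)"
      by (intro mcong_mult mcong_refl mat mcong_sym[OF s(3)])
    moreover have "?g * g * ?s = ?s"
      using G.l_inv[OF s(1)] mat by (simp add: GL_simps)
    moreover have "?g * s * ?s = ?g"
      using G.m_assoc[of ?g s ?s] G.r_inv[OF sG] G.r_one[of ?g] sG s(1) by (simp add: GL_simps)
    ultimately show "?g \<in> ?L"
      using s(1) S.m_inv_closed[OF s(2)] G.inv_closed[OF s(1)] by auto
  next
    fix g h assume "g \<in> ?L" "h \<in> ?L"
    then obtain s t where "g \<in> carrier ?G" "s \<in> S" "mcong n m g s" "h \<in> carrier ?G" "t \<in> S" "mcong n m h t"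
      by blast
    then show "g \<otimes>\<^bsub>?G\<^esub> h \<in> ?L"
      using mcong_mult[of n m g s h t] G.m_closed[of g h] S.m_closed[of s t]
      unfolding GL_simps by blast
  qed blast
qed

lemma finite_image_factor:
  assumes "finite (r ` A)" and "\<And>x y. x \<in> A \<Longrightarrow> y \<in> A \<Longrightarrow> r x = r y \<Longrightarrow> f x = f y"
  shows "finite (f ` A)"
proof (rule finite_subset)
  show "f ` A \<subseteq> (\<lambda>z. f (inv_into A r z)) ` r ` A"
  proof
    fix b assume "b \<in> f ` A"
    then obtain x where x: "x \<in> A" "b = f x" by blast
    then have "f x = f (inv_into A r (r x))"
      by (intro assms(2)) (auto intro: inv_into_into simp: f_inv_into_f)
    then show "b \<in> (\<lambda>z. f (inv_into A r z)) ` r ` A" using x by blast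
  qed
qed (use assms(1) in blast)

text \<open>If \<open>g\<close> and \<open>h\<close> have the same residues modulo \<open>m\<close>,
  then \<open>g * inv h\<close> is congruent to 1, an element of \<open>S\<close>, so both lie in
  the same coset. There are only finitely many matrices of residues.\<close>

lemma mcong_nhd_finite_index:
  assumes S: "subgroup S (GL TYPE(int) n)" and m: "m > 0"
  shows "finite_index_subgroup {g \<in> carrier (GL TYPE(int) n). \<exists>s\<in>S. mcong n m g s} (GL TYPE(int) n)"
    (is "finite_index_subgroup _ ?G")
proof -
  interpret G: group ?G by (rule group_GL)
  define L where "L = {g \<in> carrier ?G. \<exists>s\<in>S. mcong n m g s}"
  interpret L: subgroup L ?G unfolding L_def by (rule mcong_nhd_subgroup[OF S])
  interpret S: subgroup S ?G by (rule S)
  let ?I = "{..<n} \<times> {..<n}"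
  \<comment> \<open>Restricting to the index square places the residues in a finite set of
    extensional functions.\<close>
  define r where "r = (\<lambda>g. restrict (\<lambda>ij. g $$ ij mod m) ?I)"
  have "r ` carrier ?G \<subseteq> PiE ?I (\<lambda>_. {0..<m})"
    using m by (intro image_subsetI PiE_I) (simp_all add: r_def restrict_def)
  then have "finite (r ` carrier ?G)"
    by (rule finite_subset) (intro finite_PiE; simp)
  moreover have "L #>\<^bsub>?G\<^esub> g = L #>\<^bsub>?G\<^esub> h"
    if g: "g \<in> carrier ?G" and h: "h \<in> carrier ?G" and r: "r g = r h" for g h
  proof -
    have "g $$ (i, j) mod m = h $$ (i, j) mod m" if "i < n" "j < n" for i j
      using fun_cong[OF r, of "(i, j)"] that by (simp add: r_def)
    then have "mcong n m g h"
      using GL_carrier_mat[OF g] GL_carrier_mat[OF h] by (simp add: mcong_def cong_def)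
    then have "mcong n m (g * inv\<^bsub>?G\<^esub> h) (h * inv\<^bsub>?G\<^esub> h)"
      by (rule mcong_mult[OF _ mcong_refl[OF GL_carrier_mat[OF G.inv_closed[OF h]]]])
    then have "mcong n m (g \<otimes>\<^bsub>?G\<^esub> inv\<^bsub>?G\<^esub> h) \<one>\<^bsub>?G\<^esub>"
      using G.r_inv[OF h] by (simp add: GL_simps)
    then have "g \<otimes>\<^bsub>?G\<^esub> inv\<^bsub>?G\<^esub> h \<in> L"
      using G.m_closed[OF g G.inv_closed[OF h]] S.one_closed unfolding L_def by blast
    then have "g \<in> L #>\<^bsub>?G\<^esub> h"
      using L.rcos_module[OF G.is_group h g] by blast
    then show ?thesis
      using G.repr_independence[OF _ h L.subgroup_axioms] by blast
  qed
  ultimately have "finite ((\<lambda>g. L #>\<^bsub>?G\<^esub> g) ` carrier ?G)"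
    by (rule finite_image_factor)
  then show ?thesis
    unfolding finite_index_subgroup_def RCOSETS_def L_def[symmetric]
    using L.subgroup_axioms by (simp add: UNION_singleton_eq_range)
qed

section \<open>Roots in unipotent groups of integer matrices\<close>

text \<open>In the application \<open>E k\<close> consists of the integer matrices \<open>a\<close> such that \<open>P a P\<inverse>\<close> vanishes
  below the \<open>k\<close>-th superdiagonal, where \<open>P\<close> triangularizes \<open>U\<close>. Since the entries of \<open>P\<close> are
  arbitrary complex numbers, only purity is known about the successive quotients.\<close>

locale unipotent_filtration =
  fixes n :: nat and E :: "nat \<Rightarrow> int mat set" and U :: "int mat set"
  assumes E_carrier: "E k \<subseteq> carrier_mat n n"
    and zero_E: "0\<^sub>m n n \<in> E k"
    and one_E: "1\<^sub>m n \<in> E 0"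
    and diff_E: "a \<in> E k \<Longrightarrow> b \<in> E k \<Longrightarrow> a - b \<in> E k"
    and mult_E: "a \<in> E k \<Longrightarrow> b \<in> E l \<Longrightarrow> a * b \<in> E (k + l)"
    and E_Suc: "E (Suc k) \<subseteq> E k"
    and pure_E: "a \<in> carrier_mat n n \<Longrightarrow> c \<noteq> 0 \<Longrightarrow> c \<cdot>\<^sub>m a \<in> E k \<Longrightarrow> a \<in> E k"
    and E_top: "E n = {0\<^sub>m n n}"
    and subgroup_U: "subgroup U (GL TYPE(int) n)"
    and U_E: "u \<in> U \<Longrightarrow> u - 1\<^sub>m n \<in> E 1"
begin

abbreviation "G \<equiv> GL TYPE(int) n"
abbreviation "C \<equiv> carrier_mat n n :: int mat set"

sublocale G: group G by (rule group_GL)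
sublocale U: subgroup U G by (rule subgroup_U)

lemma E_mat: "a \<in> E k \<Longrightarrow> a \<in> C"
  using E_carrier by blast

lemma add_E: "a \<in> E k \<Longrightarrow> b \<in> E k \<Longrightarrow> a + b \<in> E k"
proof -
  assume ab: "a \<in> E k" "b \<in> E k"
  then have "a - (0\<^sub>m n n - b) \<in> E k" by (intro diff_E zero_E)
  also have "a - (0\<^sub>m n n - b) = a + b"
    using ab[THEN E_mat] by (intro eq_matI) auto
  finally show ?thesis .
qed

lemma smult_E:
  assumes a: "a \<in> E k"
  shows "c \<cdot>\<^sub>m a \<in> E k"
proof (induction c rule: int_induct[of _ 0])
  case base
  have "0 \<cdot>\<^sub>m a = 0\<^sub>m n n" using E_mat[OF a] by (intro eq_matI) auto
  then show ?case by (simp add: zero_E)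
next
  case (step1 c)
  have "c \<cdot>\<^sub>m a + a = (c + 1) \<cdot>\<^sub>m a"
    using E_mat[OF a] by (intro eq_matI) (auto simp: algebra_simps)
  then show ?case using add_E[OF step1(2) a] by simp
next
  case (step2 c)
  have "c \<cdot>\<^sub>m a - a = (c - 1) \<cdot>\<^sub>m a"
    using E_mat[OF a] by (intro eq_matI) (auto simp: algebra_simps)
  then show ?case using diff_E[OF step2(2) a] by simp
qed

section \<open>Arithmetic modulo the filtration and uniqueness of roots\<close>

text \<open>Congruence modulo the additive group \<open>E k\<close>. The carrier conditions are
  included so that matrix identities such as \<open>(a - b) + b = a\<close> follow from the relation
  alone.\<close>

definition eqv :: "nat \<Rightarrow> int mat \<Rightarrow> int mat \<Rightarrow> bool" where
  "eqv k a b \<longleftrightarrow> a \<in> C \<and> b \<in> C \<and> a - b \<in> E k"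

lemma eqv_refl: "a \<in> C \<Longrightarrow> eqv k a a"
  using zero_E by (simp add: eqv_def)

lemma eqv_sym:
  assumes "eqv k a b" shows "eqv k b a"
proof -
  have "0\<^sub>m n n - (a - b) = b - a"
    using assms by (intro eq_matI) (auto simp: eqv_def)
  then show ?thesis
    using assms diff_E[OF zero_E, of "a - b" k] by (simp add: eqv_def)
qed

lemma eqv_add:
  assumes "eqv k a b" "eqv k c d" shows "eqv k (a + c) (b + d)"
proof -
  have "(a - b) + (c - d) = (a + c) - (b + d)"
    using assms by (intro eq_matI) (auto simp: eqv_def)
  then show ?thesis
    using assms add_E[of "a - b" k "c - d"] by (simp add: eqv_def)
qed

lemma eqv_trans:
  assumes "eqv k a b" "eqv k b c" shows "eqv k a c"
proof -
  have "(a - b) + (b - c) = a - c"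
    using assms by (intro eq_matI) (auto simp: eqv_def)
  then show ?thesis
    using assms add_E[of "a - b" k "b - c"] by (simp add: eqv_def)
qed

lemma eqv_smult:
  assumes "eqv k a b" shows "eqv k (c \<cdot>\<^sub>m a) (c \<cdot>\<^sub>m b)"
proof -
  have "c \<cdot>\<^sub>m (a - b) = c \<cdot>\<^sub>m a - c \<cdot>\<^sub>m b"
    using assms by (intro eq_matI) (auto simp: eqv_def algebra_simps)
  then show ?thesis
    using assms smult_E[of "a - b" k c] by (simp add: eqv_def)
qed

lemma eqv_mem: "eqv k a b \<Longrightarrow> b \<in> E k \<Longrightarrow> a \<in> E k"
proof -
  assume ab: "eqv k a b" "b \<in> E k"
  have "(a - b) + b = a"
    using ab by (intro eq_matI) (auto simp: eqv_def)
  then show ?thesis using ab add_E[of "a - b" k b] by (simp add: eqv_def)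
qed

lemma eqv_Suc: "eqv (Suc k) a b \<Longrightarrow> eqv k a b"
  using E_Suc[of k] by (auto simp: eqv_def)

lemma eqv_top: "eqv n a b \<Longrightarrow> a = b"
proof -
  assume ab: "eqv n a b"
  then have "(a - b) + b = 0\<^sub>m n n + b" using E_top by (simp add: eqv_def)
  moreover have "(a - b) + b = a"
    using ab by (intro eq_matI) (auto simp: eqv_def)
  ultimately show ?thesis using ab by (simp add: eqv_def)
qed

lemma U_mat: "u \<in> U \<Longrightarrow> u \<in> C"
  using GL_carrier_mat U.subset by blast

lemma U_pow: "u \<in> U \<Longrightarrow> u [^]\<^bsub>G\<^esub> (j::nat) \<in> U"
  by (induction j) auto

text \<open>Since \<open>a * u - a = a * (u - 1)\<close> lies in \<open>E (k + 1)\<close>, right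
  multiplication by \<open>U\<close> is trivial on \<open>E k\<close> modulo
  \<open>E (k + 1)\<close>.\<close>

lemma U_mult_right:
  assumes u: "u \<in> U" and a: "a \<in> E k"
  shows "eqv (Suc k) (a * u) a"
proof -
  have "a * (u - 1\<^sub>m n) = a * u - a"
    using E_mat[OF a] U_mat[OF u] by (simp add: mult_minus_distrib_mat[of _ n n _ n])
  then show ?thesis
    using mult_E[OF a U_E[OF u]] E_mat[OF a] U_mat[OF u] by (simp add: eqv_def)
qed

lemma U_mult_left:
  assumes u: "u \<in> U" and a: "a \<in> E k"
  shows "eqv (Suc k) (u * a) a"
proof -
  have "(u - 1\<^sub>m n) * a = u * a - a"
    using E_mat[OF a] U_mat[OF u] by (simp add: minus_mult_distrib_mat[of _ n n _ _ n])
  then show ?thesis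
    using mult_E[OF U_E[OF u] a] E_mat[OF a] U_mat[OF u] by (simp add: eqv_def)
qed

text \<open>Telescoping gives \<open>x^(j+1) - y^(j+1) = (x^j - y^j) * x + y^j * (x - y)\<close>,
  and the factors from \<open>U\<close> drop out modulo \<open>E (k + 1)\<close>. So a
  \<open>j\<close>-th power multiplies the leading difference by \<open>j\<close>.\<close>

lemma pow_diff:
  assumes x: "x \<in> U" and y: "y \<in> U" and xy: "x - y \<in> E k"
  shows "eqv (Suc k) (x [^]\<^bsub>G\<^esub> (j::nat) - y [^]\<^bsub>G\<^esub> j) (int j \<cdot>\<^sub>m (x - y))"
proof (induction j)
  case 0
  have "1\<^sub>m n - 1\<^sub>m n = (0 \<cdot>\<^sub>m (x - y) :: int mat)"
    using U_mat[OF x] U_mat[OF y] by (intro eq_matI) auto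
  then show ?case using U_mat[OF x] U_mat[OF y] by (simp add: eqv_refl GL_simps minus_carrier_mat)
next
  case (Suc j)
  let ?X = "x [^]\<^bsub>G\<^esub> j" and ?Y = "y [^]\<^bsub>G\<^esub> j"
  have mat: "x \<in> C" "y \<in> C" "?X \<in> C" "?Y \<in> C"
    using x y U_pow U_mat by auto
  have "?X - ?Y \<in> E k"
    using eqv_mem[OF eqv_Suc[OF Suc] smult_E[OF xy]] .
  then have "eqv (Suc k) ((?X - ?Y) * x) (int j \<cdot>\<^sub>m (x - y))"
    using eqv_trans[OF U_mult_right[OF x] Suc] by blast
  moreover have "eqv (Suc k) (?Y * (x - y)) (x - y)"
    by (rule U_mult_left[OF U_pow[OF y] xy])
  ultimately have "eqv (Suc k) ((?X - ?Y) * x + ?Y * (x - y)) (int j \<cdot>\<^sub>m (x - y) + (x - y))"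
    by (rule eqv_add)
  also have "(?X - ?Y) * x + ?Y * (x - y) = (?X * x - ?Y * x) + (?Y * x - ?Y * y)"
    using mat by (simp add: mult_minus_distrib_mat[of _ n n _ n] minus_mult_distrib_mat[of _ n n _ _ n])
  also have "\<dots> = ?X * x - ?Y * y"
    using mat by (intro eq_matI) (auto simp del: index_mult_mat(1))
  also have "int j \<cdot>\<^sub>m (x - y) + (x - y) = int (Suc j) \<cdot>\<^sub>m (x - y)"
    using mat by (intro eq_matI) (auto simp: algebra_simps)
  finally show ?case by (simp add: GL_simps)
qed

text \<open>The difference \<open>x - y\<close> climbs the filtration up to
  \<open>E n = {0}\<close>: once it lies in \<open>E k\<close>, \<open>pow_diff\<close> puts its
  multiple by \<open>N\<close> into \<open>E (k + 1)\<close>, and purity allows division by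
  \<open>N\<close>.\<close>

lemma root_unique:
  assumes x: "x \<in> U" and y: "y \<in> U" and N: "N > 0"
    and eq: "x [^]\<^bsub>G\<^esub> (N::nat) = y [^]\<^bsub>G\<^esub> N"
  shows "x = y"
proof -
  have mat: "x \<in> C" "y \<in> C" using x y U_mat by auto
  have "x - y \<in> E k" for k
  proof (induction k)
    case 0
    have "eqv 0 x (1\<^sub>m n)" "eqv 0 y (1\<^sub>m n)"
      using U_E[of x] U_E[of y] E_Suc[of 0] x y mat by (auto simp: eqv_def)
    then have "eqv 0 x y" by (blast intro: eqv_trans eqv_sym)
    then show ?case by (simp add: eqv_def)
  next
    case (Suc k)
    have "x [^]\<^bsub>G\<^esub> N - y [^]\<^bsub>G\<^esub> N = 0\<^sub>m n n"
      using eq U_mat[OF U_pow[OF x]] U_mat[OF U_pow[OF y]] by simp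
    then have "eqv (Suc k) (0\<^sub>m n n) (int N \<cdot>\<^sub>m (x - y))"
      using pow_diff[OF x y Suc, of N] by simp
    then have "int N \<cdot>\<^sub>m (x - y) \<in> E (Suc k)"
      using eqv_mem[OF eqv_sym] zero_E by blast
    then show ?case using pure_E[of "x - y" "int N"] mat N by (simp add: minus_carrier_mat)
  qed
  then show ?thesis using mat by (intro eqv_top) (simp add: eqv_def)
qed

lemma pow_minus_one_E:
  assumes u: "u \<in> U"
  shows "(u - 1\<^sub>m n) ^\<^sub>m k \<in> E k"
proof (induction k)
  case 0
  then show ?case using U_mat[OF u] by (simp add: one_E)
next
  case (Suc k)
  then show ?case using mult_E[OF Suc U_E[OF u]] by simp
qed

lemma pow_minus_one_top:
  assumes "u \<in> U"
  shows "(u - 1\<^sub>m n) ^\<^sub>m n = 0\<^sub>m n n"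
  using pow_minus_one_E[OF assms, of n] E_top by simp

text \<open>Downward induction on \<open>k\<close>: the approximate root \<open>v\<close> is corrected to \<open>w = v y\<^sup>M\<close>. For
  \<open>u = v\<^sup>N r\<close>, the torsion bound makes \<open>r - 1\<close> congruent to \<open>N M (y - 1)\<close> modulo \<open>E (k + 1)\<close> for some
  \<open>y \<in> U\<close>, where \<open>M\<close> is chosen such that \<open>M\<close>-th powers are congruent to \<open>1\<close> modulo the modulus of
  the next step.\<close>

lemma root_of_congruent_to_one_aux:
  assumes N: "N > 0"
  shows "k + d = n \<Longrightarrow> \<exists>m>0. \<forall>u\<in>U. \<forall>v\<in>U. mcong n m u (1\<^sub>m n) \<longrightarrow> mcong n m v (1\<^sub>m n) \<longrightarrow>
           u - v [^]\<^bsub>G\<^esub> (N::nat) \<in> E k \<longrightarrow> (\<exists>w\<in>U. w [^]\<^bsub>G\<^esub> N = u)"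
proof (induction d arbitrary: k)
  \<comment> \<open>Here \<open>k = n\<close>, and \<open>E n = {0}\<close> makes \<open>v\<close>
    itself a root, so the modulus 1 will do.\<close>
  case 0
  have "v [^]\<^bsub>G\<^esub> N = u" if "u \<in> U" "v \<in> U" "u - v [^]\<^bsub>G\<^esub> N \<in> E k" for u v
  proof -
    have "eqv n u (v [^]\<^bsub>G\<^esub> N)"
      using that U_mat[OF U_pow[of v N]] U_mat[of u] 0 by (simp add: eqv_def)
    then show ?thesis by (rule eqv_top[symmetric])
  qed
  then show ?case by (intro exI[of _ 1]) auto
next
  case (Suc d)
  then obtain m' where m': "m' > 0" and IH: "\<And>u v. u \<in> U \<Longrightarrow> v \<in> U \<Longrightarrow> mcong n m' u (1\<^sub>m n) \<Longrightarrow>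
      mcong n m' v (1\<^sub>m n) \<Longrightarrow> u - v [^]\<^bsub>G\<^esub> N \<in> E (Suc k) \<Longrightarrow> \<exists>w\<in>U. w [^]\<^bsub>G\<^esub> N = u"
    using Suc.IH[of "Suc k"] by auto
  have cong_subgroup: "subgroup {g \<in> carrier G. mcong n c g (1\<^sub>m n)} G" for c
    using mcong_nhd_subgroup[OF G.triv_subgroup, of c] by (simp add: GL_simps)
  \<comment> \<open>A single \<open>M\<close> works for all of \<open>G\<close> because the
    principal congruence subgroup of level \<open>m'\<close> has finite index.\<close>
  have "finite_index_subgroup {g \<in> carrier G. mcong n m' g (1\<^sub>m n)} G"
    using mcong_nhd_finite_index[OF G.triv_subgroup m'] by (simp add: GL_simps)
  then obtain M :: nat where M: "M > 0" "\<And>g. g \<in> carrier G \<Longrightarrow> mcong n m' (g [^]\<^bsub>G\<^esub> M) (1\<^sub>m n)"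
    using G.exists_pow_mem_finite_index unfolding finite_index_subgroup_def by blast
  \<comment> \<open>\<open>H\<close> consists of the integer matrices that agree modulo
    \<open>E (k + 1)\<close> with some \<open>y - 1\<close> in \<open>E k\<close>, where
    \<open>y\<close> is in \<open>U\<close>. Matrices are written as functions on index pairs to fit
    the torsion bound; values outside the square do not matter.\<close>
  define H where "H = {f. \<exists>y\<in>U. y - 1\<^sub>m n \<in> E k \<and> eqv (Suc k) (mat n n f) (y - 1\<^sub>m n)}"
  have zero_H: "(\<lambda>_. 0) \<in> H"
  proof -
    have zero: "1\<^sub>m n - 1\<^sub>m n = (0\<^sub>m n n :: int mat)" "mat n n (\<lambda>_. 0) = (0\<^sub>m n n :: int mat)"
      by (intro eq_matI; simp)+
    have "1\<^sub>m n \<in> U" using U.one_closed by (simp add: GL_simps)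
    then show ?thesis
      unfolding H_def mem_Collect_eq zero(2) using zero_E
      by (intro bexI[of _ "1\<^sub>m n"] conjI) (simp_all only: zero(1) eqv_refl zero_carrier_mat)
  qed
  have diff_H: "(\<lambda>i. f i - g i) \<in> H" if fg: "f \<in> H" "g \<in> H" for f g
  proof -
    obtain y z where y: "y \<in> U" "y - 1\<^sub>m n \<in> E k" "eqv (Suc k) (mat n n f) (y - 1\<^sub>m n)"
      and z: "z \<in> U" "z - 1\<^sub>m n \<in> E k" "eqv (Suc k) (mat n n g) (z - 1\<^sub>m n)"
      using fg by (auto simp: H_def)
    define z' where "z' = inv\<^bsub>G\<^esub> z"
    have z': "z' \<in> U" using z by (simp add: z'_def)
    note mat = y(1)[THEN U_mat] z(1)[THEN U_mat] z'[THEN U_mat]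
    have yz: "(y - 1\<^sub>m n) - (z - 1\<^sub>m n) = y - z"
      using mat by (intro eq_matI) auto
    have yzE: "y - z \<in> E k"
      using diff_E[OF y(2) z(2)] by (simp add: yz)
    \<comment> \<open>The difference of \<open>y - 1\<close> and \<open>z - 1\<close> is represented
      by \<open>y * z'\<close>: \<open>(y - z) * z' = y * z' - 1\<close>, and the factor
      \<open>z'\<close> drops out modulo \<open>E (k + 1)\<close>.\<close>
    have "z * z' = 1\<^sub>m n"
      using G.r_inv[of z] z(1) by (simp add: z'_def GL_simps)
    then have "(y - z) * z' = y * z' - 1\<^sub>m n"
      using mat by (simp add: minus_mult_distrib_mat[of _ n n _ _ n])
    then have t: "eqv (Suc k) (y * z' - 1\<^sub>m n) (y - z)"
      using U_mult_right[OF z' yzE] by simp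
    have "y * z' \<in> U" using U.m_closed[OF y(1) z'] by (simp add: GL_simps)
    moreover have "y * z' - 1\<^sub>m n \<in> E k"
      using eqv_mem[OF eqv_Suc[OF t] yzE] .
    moreover have "eqv (Suc k) (mat n n (\<lambda>i. f i - g i)) (y * z' - 1\<^sub>m n)"
    proof -
      have "mat n n f + (-1) \<cdot>\<^sub>m mat n n g = mat n n (\<lambda>i. f i - g i)"
        by (intro eq_matI) auto
      moreover have "(y - 1\<^sub>m n) + (-1) \<cdot>\<^sub>m (z - 1\<^sub>m n) = y - z"
        using mat by (intro eq_matI) auto
      ultimately have "eqv (Suc k) (mat n n (\<lambda>i. f i - g i)) (y - z)"
        using eqv_add[OF y(3) eqv_smult[OF z(3), of "-1"]] by simp
      then show ?thesis using eqv_trans eqv_sym[OF t] by blast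
    qed
    ultimately show ?thesis by (auto simp: H_def)
  qed
  let ?I = "{..<n} \<times> {..<n}"
  have "\<exists>e::int. e > 0 \<and> (\<forall>b. (\<forall>i. i \<notin> ?I \<longrightarrow> b i = 0) \<longrightarrow>
      (\<exists>c>0. (\<lambda>i. c * b i) \<in> H) \<longrightarrow> (\<lambda>i. e * b i) \<in> H)"
  proof (rule torsion_modulo_subgroup_bounded)
    show "(\<lambda>i. f i - g i) \<in> H" if "f \<in> H" "g \<in> H" for f g
      by (rule diff_H[OF that])
  qed (simp_all add: zero_H)
  then obtain e :: int where e: "e > 0" and e_torsion: "\<forall>b. (\<forall>i. i \<notin> ?I \<longrightarrow> b i = 0) \<longrightarrow>
      (\<exists>c>0. (\<lambda>i. c * b i) \<in> H) \<longrightarrow> (\<lambda>i. e * b i) \<in> H"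
    by (elim exE conjE)
  \<comment> \<open>The factor \<open>m'\<close> makes \<open>m'\<close> divide \<open>m\<close>, so
    that the congruences persist in the next step; the factor \<open>M\<close> makes
    \<open>M'\<close>-th powers congruent to 1 modulo \<open>m'\<close>. In \<open>m\<close>, the
    factor \<open>e\<close> removes torsion modulo \<open>H\<close>, and \<open>N * M'\<close> is
    left over for the correction.\<close>
  define M' where "M' = nat m' * M"
  define m where "m = int N * int M' * e"
  have m: "m > 0" "m' dvd m"
    using N M m' e by (auto simp: m_def M'_def)
  show ?case
  proof (intro exI[of _ m] conjI ballI impI)
    show "m > 0" by (rule m(1))
    fix u v assume u: "u \<in> U" and v: "v \<in> U" and u1: "mcong n m u (1\<^sub>m n)"
      and v1: "mcong n m v (1\<^sub>m n)" and uv: "u - v [^]\<^bsub>G\<^esub> N \<in> E k"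
    let ?V = "v [^]\<^bsub>G\<^esub> N"
    define V' where "V' = inv\<^bsub>G\<^esub> ?V"
    define r where "r = V' * u"
    have V: "?V \<in> U" by (rule U_pow[OF v])
    have V': "V' \<in> U" using V by (simp add: V'_def)
    have r: "r \<in> U" using U.m_closed[OF V' u] by (simp add: r_def GL_simps)
    note mat = u[THEN U_mat] v[THEN U_mat] V[THEN U_mat] V'[THEN U_mat] r[THEN U_mat]
    have r1: "mcong n m r (1\<^sub>m n)"
    proof -
      define K where "K = {g \<in> carrier G. mcong n m g (1\<^sub>m n)}"
      have K: "u \<in> K" "v \<in> K"
        unfolding K_def using u1 v1 U.mem_carrier[OF u] U.mem_carrier[OF v] by blast+
      interpret K: subgroup K G unfolding K_def by (rule cong_subgroup)
      have "v [^]\<^bsub>G\<^esub> j \<in> K" for j :: nat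
        by (induction j) (use K in auto)
      then have "V' \<in> K" by (simp add: V'_def)
      then have "V' \<otimes>\<^bsub>G\<^esub> u \<in> K" using K by simp
      then have "mcong n m (V' \<otimes>\<^bsub>G\<^esub> u) (1\<^sub>m n)" unfolding K_def by blast
      then show ?thesis by (simp add: r_def GL_simps)
    qed
    have ruv: "eqv (Suc k) (r - 1\<^sub>m n) (u - ?V)"
    proof -
      have "V' * ?V = 1\<^sub>m n"
        using G.l_inv[of ?V] V by (simp add: V'_def GL_simps)
      then have "V' * (u - ?V) = r - 1\<^sub>m n"
        using mat by (simp add: r_def mult_minus_distrib_mat[of _ n n _ n])
      then show ?thesis using U_mult_left[OF V' uv] by simp
    qed
    have rE: "r - 1\<^sub>m n \<in> E k"
      using eqv_mem[OF eqv_Suc[OF ruv] uv] .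
    \<comment> \<open>As \<open>r\<close> is congruent to 1, \<open>r - 1\<close> is
      \<open>m\<close> times an integer matrix \<open>b\<close>. Since \<open>m * b\<close> is in
      \<open>H\<close>, \<open>b\<close> is torsion modulo \<open>H\<close>, and so
      \<open>e * b\<close> is in \<open>H\<close>. Off the square \<open>b\<close> is 0, as the
      torsion bound demands.\<close>
    define b where "b = (\<lambda>ij. if ij \<in> ?I then (r - 1\<^sub>m n) $$ ij div m else 0)"
    have mb: "mat n n (\<lambda>ij. m * b ij) = r - 1\<^sub>m n"
      using r1 mat by (intro eq_matI) (auto simp: b_def mcong_def cong_iff_dvd_diff)
    have "(\<lambda>ij. m * b ij) \<in> H"
      using r rE mat by (auto simp: H_def mb intro!: bexI[of _ r] eqv_refl minus_carrier_mat)
    then have "(\<lambda>ij. e * b ij) \<in> H"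
      using e_torsion[rule_format, of b] m(1) by (auto simp: b_def)
    then obtain y where y: "y \<in> U" "y - 1\<^sub>m n \<in> E k" "eqv (Suc k) (mat n n (\<lambda>ij. e * b ij)) (y - 1\<^sub>m n)"
      by (auto simp: H_def)
    have "(int N * int M') \<cdot>\<^sub>m mat n n (\<lambda>ij. e * b ij) = r - 1\<^sub>m n"
      unfolding mb[symmetric] by (intro eq_matI) (auto simp: m_def)
    then have ry: "eqv (Suc k) (r - 1\<^sub>m n) ((int N * int M') \<cdot>\<^sub>m (y - 1\<^sub>m n))"
      using eqv_smult[OF y(3), of "int N * int M'"] by simp
    define g where "g = y [^]\<^bsub>G\<^esub> M'"
    have g: "g \<in> U" by (simp add: g_def U_pow y)
    have g1: "mcong n m' g (1\<^sub>m n)"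
      using M(2)[of "y [^]\<^bsub>G\<^esub> nat m'"] y(1) by (simp add: g_def M'_def G.nat_pow_pow)
    have gy: "eqv (Suc k) (g - 1\<^sub>m n) (int M' \<cdot>\<^sub>m (y - 1\<^sub>m n))"
      using pow_diff[OF y(1) U.one_closed, of k M'] y(2)
      unfolding G.nat_pow_one by (simp add: g_def GL_simps)
    have gE: "g - 1\<^sub>m n \<in> E k"
      using eqv_mem[OF eqv_Suc[OF gy] smult_E[OF y(2)]] .
    \<comment> \<open>Modulo \<open>E (k + 1)\<close>, the difference \<open>w^N - v^N\<close> is
      successively congruent to \<open>N (w - v)\<close>, \<open>N (g - 1)\<close>,
      \<open>N M' (y - 1)\<close>, \<open>r - 1\<close> and \<open>u - v^N\<close>. So
      \<open>w\<close> is a root one level deeper.\<close>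
    define w where "w = v * g"
    have w: "w \<in> U" using U.m_closed[OF v g] by (simp add: w_def GL_simps)
    note mat' = y(1)[THEN U_mat] g[THEN U_mat] w[THEN U_mat] U_pow[OF w, of N, THEN U_mat]
    have wv: "eqv (Suc k) (w - v) (g - 1\<^sub>m n)"
    proof -
      have "v * (g - 1\<^sub>m n) = w - v"
        using mat mat' by (simp add: w_def mult_minus_distrib_mat[of _ n n _ n])
      then show ?thesis using U_mult_left[OF v gE] by simp
    qed
    have wvE: "w - v \<in> E k"
      using eqv_mem[OF eqv_Suc[OF wv] gE] .
    have "eqv (Suc k) (w [^]\<^bsub>G\<^esub> N - ?V) (int N \<cdot>\<^sub>m (w - v))"
      by (rule pow_diff[OF w v wvE])
    moreover have "eqv (Suc k) (int N \<cdot>\<^sub>m (w - v)) (int N \<cdot>\<^sub>m (int M' \<cdot>\<^sub>m (y - 1\<^sub>m n)))"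
      by (intro eqv_smult eqv_trans[OF wv gy])
    moreover have "int N \<cdot>\<^sub>m (int M' \<cdot>\<^sub>m (y - 1\<^sub>m n)) = (int N * int M') \<cdot>\<^sub>m (y - 1\<^sub>m n)"
      by (intro eq_matI) auto
    ultimately have "eqv (Suc k) (w [^]\<^bsub>G\<^esub> N - ?V) (u - ?V)"
      using eqv_sym[OF ry] ruv by (metis eqv_trans)
    then have "eqv (Suc k) (u - ?V) (w [^]\<^bsub>G\<^esub> N - ?V)" by (rule eqv_sym)
    moreover have "(u - ?V) - (w [^]\<^bsub>G\<^esub> N - ?V) = u - w [^]\<^bsub>G\<^esub> N"
      using mat mat' by (intro eq_matI) auto
    ultimately have "u - w [^]\<^bsub>G\<^esub> N \<in> E (Suc k)"
      by (simp add: eqv_def)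
    moreover have "mcong n m' w (1\<^sub>m n)"
      using mcong_mult[OF mcong_dvd[OF v1 m(2)] g1] by (simp add: w_def)
    ultimately show "\<exists>w\<in>U. w [^]\<^bsub>G\<^esub> N = u"
      using IH[OF u w mcong_dvd[OF u1 m(2)]] by blast
  qed
qed

text \<open>The approximation starts with \<open>v = 1\<close> at level 0: \<open>u - 1\<close> lies
  in \<open>E 1\<close>, hence in \<open>E 0\<close>, and only the congruence of \<open>u\<close> to
  1 remains as a condition.\<close>

lemma root_of_congruent_to_one:
  assumes N: "N > 0"
  obtains m where "m > 0"
    "\<And>u. u \<in> U \<Longrightarrow> mcong n m u (1\<^sub>m n) \<Longrightarrow> \<exists>w\<in>U. w [^]\<^bsub>G\<^esub> (N::nat) = u"
proof -
  obtain m where m: "m > 0" "\<And>u v. u \<in> U \<Longrightarrow> v \<in> U \<Longrightarrow> mcong n m u (1\<^sub>m n) \<Longrightarrow>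
      mcong n m v (1\<^sub>m n) \<Longrightarrow> u - v [^]\<^bsub>G\<^esub> N \<in> E 0 \<Longrightarrow> \<exists>w\<in>U. w [^]\<^bsub>G\<^esub> N = u"
    using root_of_congruent_to_one_aux[OF N, of 0 n] by auto
  have "\<exists>w\<in>U. w [^]\<^bsub>G\<^esub> N = u" if u: "u \<in> U" "mcong n m u (1\<^sub>m n)" for u
  proof (rule m(2)[OF u(1) U.one_closed u(2)])
    show "u - \<one>\<^bsub>G\<^esub> [^]\<^bsub>G\<^esub> N \<in> E 0"
      unfolding G.nat_pow_one using U_E[OF u(1)] E_Suc[of 0] by (auto simp: GL_simps)
  qed (simp add: GL_simps mcong_refl)
  then show ?thesis using that m(1) by blast
qed

end

section \<open>The band filtration and its pullback to integer matrices\<close>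

text \<open>The indexing is such that \<open>k = 0\<close> gives the upper triangular matrices,
  \<open>k = 1\<close> the strictly upper triangular ones and \<open>k = n\<close> only
  zero.\<close>

definition upper_band :: "nat \<Rightarrow> nat \<Rightarrow> 'a::zero mat set" where
  "upper_band n k = {A \<in> carrier_mat n n. \<forall>i<n. \<forall>j<n. j < i + k \<longrightarrow> A $$ (i, j) = 0}"

lemma upper_band_mult:
  fixes A B :: "'a::semiring_0 mat"
  assumes A: "A \<in> upper_band n k" and B: "B \<in> upper_band n l"
  shows "A * B \<in> upper_band n (k + l)"
proof -
  have "(\<Sum>h = 0..<n. A $$ (i, h) * B $$ (h, j)) = 0" if "i < n" "j < n" "j < i + (k + l)" for i j
  proof (intro sum.neutral ballI)
    fix h assume "h \<in> {0..<n}"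
    moreover have "h < i + k \<or> j < h + l" using that by linarith
    ultimately show "A $$ (i, h) * B $$ (h, j) = 0"
      using A B that by (auto simp: upper_band_def)
  qed
  then show ?thesis
    using A B by (auto simp: upper_band_def scalar_prod_def)
qed

lemma complex_mat_one: "complex_mat (1\<^sub>m n) = 1\<^sub>m n"
  by (rule of_int_hom.mat_hom_one)

lemma complex_mat_mult:
  "A \<in> carrier_mat nr n \<Longrightarrow> B \<in> carrier_mat n nc \<Longrightarrow> complex_mat (A * B) = complex_mat A * complex_mat B"
  by (rule of_int_hom.mat_hom_mult)

lemma complex_mat_pow: "A \<in> carrier_mat n n \<Longrightarrow> complex_mat (A ^\<^sub>m k) = complex_mat A ^\<^sub>m k"
  by (rule of_int_hom.mat_hom_pow)

lemma complex_mat_zero: "complex_mat (0\<^sub>m n k) = 0\<^sub>m n k"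
  by (intro eq_matI) auto

text \<open>Conjugation by \<open>P\<close> embeds the ring of integer matrices into the complex
  ones, and the bands are pulled back along this embedding. Bands are complex subspaces, so a
  nonzero integer factor can be cancelled, which is purity; injectivity gives the condition on
  \<open>E n\<close>.\<close>

lemma unipotent_filtration_conjugate:
  fixes P Q :: "complex mat"
  assumes P: "P \<in> carrier_mat n n" and Q: "Q \<in> carrier_mat n n"
    and PQ: "P * Q = 1\<^sub>m n" and QP: "Q * P = 1\<^sub>m n"
    and U: "subgroup U (GL TYPE(int) n)"
    and unip: "\<And>u. u \<in> U \<Longrightarrow> P * complex_mat u * Q \<in> unitriangular n"
  shows "unipotent_filtration n
           (\<lambda>k. {a \<in> carrier_mat n n. P * complex_mat a * Q \<in> upper_band n k}) U"
proof -
  define c where "c a = P * complex_mat a * Q" for a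
  have c_mat: "c a \<in> carrier_mat n n" if "a \<in> carrier_mat n n" for a
    using that P Q by (simp add: c_def)
  have c_diff: "c (a - b) = c a - c b" if "a \<in> carrier_mat n n" "b \<in> carrier_mat n n" for a b
  proof -
    have "complex_mat (a - b) = complex_mat a - complex_mat b"
      using that by (intro eq_matI) auto
    then show ?thesis
      using that P Q unfolding c_def
      by (simp add: mult_minus_distrib_mat[of _ n n _ n] minus_mult_distrib_mat[of _ n n _ _ n])
  qed
  have c_smult: "c (s \<cdot>\<^sub>m a) = of_int s \<cdot>\<^sub>m c a" if "a \<in> carrier_mat n n" for s a
  proof -
    have "complex_mat (s \<cdot>\<^sub>m a) = of_int s \<cdot>\<^sub>m complex_mat a"
      using that by (intro eq_matI) auto
    then show ?thesis
      using that P Q unfolding c_def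
      by (simp add: mult_smult_distrib[of _ n n _ n] mult_smult_assoc_mat[of _ n n _ n])
  qed
  have c_one: "c (1\<^sub>m n) = 1\<^sub>m n"
    using P PQ by (simp add: c_def complex_mat_one)
  have c_inverse: "Q * c a * P = complex_mat a" if "a \<in> carrier_mat n n" for a
  proof -
    have "Q * c a * P = (Q * P) * complex_mat a * (Q * P)"
      using that P Q by (simp add: c_def assoc_mult_mat[of _ n n _ n _ n])
    then show ?thesis using that by (simp add: QP)
  qed
  have c_mult: "c (a * b) = c a * c b" if "a \<in> carrier_mat n n" "b \<in> carrier_mat n n" for a b
  proof -
    have "c a * c b = P * complex_mat a * (Q * P) * complex_mat b * Q"
      using that P Q by (simp add: c_def assoc_mult_mat[of _ n n _ n _ n])
    then show ?thesis
      using that P Q unfolding QP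
      by (simp add: c_def complex_mat_mult[of _ n n _ n] assoc_mult_mat[of _ n n _ n _ n])
  qed
  show ?thesis
    unfolding c_def[symmetric]
  proof (rule unipotent_filtration.intro)
    fix k
    have "c (0\<^sub>m n n) = 0\<^sub>m n n"
      using P Q by (simp add: c_def complex_mat_zero)
    then show "0\<^sub>m n n \<in> {a \<in> carrier_mat n n. c a \<in> upper_band n k}"
      by (simp add: upper_band_def)
  next
    show "1\<^sub>m n \<in> {a \<in> carrier_mat n n. c a \<in> upper_band n 0}"
      by (simp add: upper_band_def c_one)
  next
    fix a b k
    assume "a \<in> {a \<in> carrier_mat n n. c a \<in> upper_band n k}" "b \<in> {a \<in> carrier_mat n n. c a \<in> upper_band n k}"
    then show "a - b \<in> {a \<in> carrier_mat n n. c a \<in> upper_band n k}"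
      by (auto simp: upper_band_def c_diff)
  next
    fix a b k l
    assume "a \<in> {a \<in> carrier_mat n n. c a \<in> upper_band n k}" "b \<in> {a \<in> carrier_mat n n. c a \<in> upper_band n l}"
    then show "a * b \<in> {a \<in> carrier_mat n n. c a \<in> upper_band n (k + l)}"
      by (auto simp: c_mult intro: upper_band_mult)
  next
    fix a k and s :: int
    assume "a \<in> carrier_mat n n" "s \<noteq> 0" "s \<cdot>\<^sub>m a \<in> {a \<in> carrier_mat n n. c a \<in> upper_band n k}"
    then show "a \<in> {a \<in> carrier_mat n n. c a \<in> upper_band n k}"
      using c_mat[of a] by (auto simp: upper_band_def c_smult)
  next
    have "a = 0\<^sub>m n n" if a: "a \<in> carrier_mat n n" "c a \<in> upper_band n n" for a
    proof -
      have "c a = 0\<^sub>m n n"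
        using a(2) by (intro eq_matI) (auto simp: upper_band_def)
      then have "complex_mat a = 0\<^sub>m n n"
        using c_inverse[OF a(1)] P Q by simp
      then have "complex_mat a $$ (i, j) = 0" if "i < n" "j < n" for i j
        using that by simp
      then show ?thesis
        using a(1) by (intro eq_matI) auto
    qed
    moreover have "c (0\<^sub>m n n) = 0\<^sub>m n n"
      using P Q by (simp add: c_def complex_mat_zero)
    ultimately show "{a \<in> carrier_mat n n. c a \<in> upper_band n n} = {0\<^sub>m n n}"
      by (auto simp: upper_band_def)
  next
    fix u assume u: "u \<in> U"
    then have "u \<in> carrier_mat n n"
      using U GL_carrier_mat subgroup.subset by blast
    moreover have "c u \<in> unitriangular n"
      using unip[OF u] by (simp add: c_def)
    ultimately show "u - 1\<^sub>m n \<in> {a \<in> carrier_mat n n. c a \<in> upper_band n 1}"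
      by (auto simp: c_diff c_one upper_band_def unitriangular_def upper_triangular_def less_Suc_eq)
  qed (use U in \<open>auto simp: upper_band_def\<close>)
qed

section \<open>Semisimple matrices and conjugation\<close>

lemma similar_mat_wit_minus_one:
  fixes A :: "'a::comm_ring_1 mat"
  assumes A: "A \<in> carrier_mat n n" and sim: "similar_mat_wit A B P Q"
  shows "similar_mat_wit (A - 1\<^sub>m n) (B - 1\<^sub>m n) P Q"
proof -
  note D = similar_mat_witD2[OF A sim]
  have "P * (B - 1\<^sub>m n) * Q = P * B * Q - P * Q"
    using D by (simp add: mult_minus_distrib_mat[of _ n n _ n] minus_mult_distrib_mat[of _ n n _ _ n])
  then show ?thesis
    using D by (intro similar_mat_witI[of _ _ n]) (auto simp: minus_carrier_mat)
qed

lemma similar_mat_wit_zero: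
  assumes "similar_mat_wit A (0\<^sub>m n n) P Q"
  shows "A = 0\<^sub>m n n"
proof -
  note D = similar_mat_witD2[OF zero_carrier_mat similar_mat_wit_sym[OF assms]]
  show ?thesis
    using similar_mat_witD(3)[OF refl assms] left_mult_zero_mat[OF D(6)] right_mult_zero_mat[OF D(7)]
    by simp
qed

text \<open>\<open>P\<close> and \<open>Q\<close> have integer entries, so conjugation preserves
  divisibility by \<open>m\<close>. This carries a congruence from an arbitrary conjugate back to
  one fixed matrix, to which \<open>m\<close> can be adapted.\<close>

lemma mcong_zero_similar:
  assumes X: "X \<in> carrier_mat n n" and sim: "similar_mat_wit X Y P Q" and X0: "mcong n m X (0\<^sub>m n n)"
  shows "mcong n m Y (0\<^sub>m n n)"
proof -
  note D = similar_mat_witD2[OF X sim]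
  have "Y = Q * X * P"
    using similar_mat_witD(3)[OF refl similar_mat_wit_sym[OF sim]] .
  moreover have "mcong n m (Q * X * P) (Q * 0\<^sub>m n n * P)"
    by (intro mcong_mult X0 mcong_refl D)
  ultimately show ?thesis using D by simp
qed

text \<open>A nonzero entry is not divisible by an integer exceeding its absolute value.\<close>

lemma mcong_zero_imp_zero:
  assumes B: "B \<in> carrier_mat n n"
  obtains m where "m > 0" "mcong n m B (0\<^sub>m n n) \<Longrightarrow> B = 0\<^sub>m n n"
proof (cases "B = 0\<^sub>m n n")
  case True
  then show ?thesis using that[of 1] by simp
next
  case False
  have "\<exists>i<n. \<exists>j<n. B $$ (i, j) \<noteq> 0"
  proof (rule ccontr)
    assume "\<not> ?thesis"
    then have "B = 0\<^sub>m n n" using B by (intro eq_matI) auto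
    with False show False by simp
  qed
  then obtain i j where ij: "i < n" "j < n" "B $$ (i, j) \<noteq> 0" by blast
  have "\<not> mcong n (\<bar>B $$ (i, j)\<bar> + 1) B (0\<^sub>m n n)"
  proof
    assume "mcong n (\<bar>B $$ (i, j)\<bar> + 1) B (0\<^sub>m n n)"
    then have "\<bar>B $$ (i, j)\<bar> + 1 dvd B $$ (i, j)"
      using ij by (auto simp: mcong_def cong_0_iff)
    then show False using ij(3) dvd_imp_le_int[of "B $$ (i, j)" "\<bar>B $$ (i, j)\<bar> + 1"] by simp
  qed
  then show ?thesis using that[of "\<bar>B $$ (i, j)\<bar> + 1"] by simp
qed

lemma mat_diag_pow: "mat_diag n f ^\<^sub>m k = mat_diag n (\<lambda>i. f i ^ k :: 'a::comm_ring_1)"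
proof (induction k)
  case 0
  have "dim_row (mat_diag n f) = n" by (simp add: mat_diag_def)
  then show ?case by simp
qed (simp add: mult.commute)

text \<open>A basis that diagonalizes \<open>A\<close> also diagonalizes \<open>A^N - 1\<close>, and
  a nilpotent diagonal complex matrix is zero. The equation descends to the integers since the
  embedding is injective.\<close>

lemma semisimple_pow_eq_one:
  assumes A: "A \<in> carrier_mat n n" and ss: "semisimple A"
    and nil: "(A ^\<^sub>m N - 1\<^sub>m n) ^\<^sub>m k = 0\<^sub>m n n"
  shows "A ^\<^sub>m N = 1\<^sub>m n"
proof -
  obtain D P Q where D: "diagonal_mat D" and sim: "similar_mat_wit (complex_mat A) D P Q"
    using ss unfolding semisimple_def similar_mat_def by blast
  have Dc: "D \<in> carrier_mat n n"
    using A by (intro similar_mat_witD2(5)[OF _ sim]) simp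
  define d where "d i = D $$ (i, i)" for i
  have Dd: "D = mat_diag n d"
    using D Dc by (intro eq_matI) (auto simp: mat_diag_def diagonal_mat_def d_def)
  have AN: "A ^\<^sub>m N \<in> carrier_mat n n" using A by simp
  have homM: "complex_mat (A ^\<^sub>m N - 1\<^sub>m n) = complex_mat A ^\<^sub>m N - 1\<^sub>m n"
  proof -
    have "complex_mat (B - 1\<^sub>m n) = complex_mat B - complex_mat (1\<^sub>m n)"
      if "B \<in> carrier_mat n n" for B
      using that by (intro eq_matI) auto
    from this[OF AN] have "complex_mat (A ^\<^sub>m N - 1\<^sub>m n) = complex_mat (A ^\<^sub>m N) - complex_mat (1\<^sub>m n)" .
    then show ?thesis
      by (simp add: complex_mat_pow[OF A] complex_mat_one)
  qed
  have "similar_mat_wit (complex_mat A ^\<^sub>m N - 1\<^sub>m n) (D ^\<^sub>m N - 1\<^sub>m n) P Q"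
    using A by (intro similar_mat_wit_minus_one similar_mat_wit_pow sim) simp
  moreover have "D ^\<^sub>m N - 1\<^sub>m n = mat_diag n (\<lambda>i. d i ^ N - 1)"
    unfolding Dd mat_diag_pow by (intro eq_matI) (auto simp: mat_diag_def)
  ultimately have simM: "similar_mat_wit (complex_mat (A ^\<^sub>m N - 1\<^sub>m n)) (mat_diag n (\<lambda>i. d i ^ N - 1)) P Q"
    by (simp add: homM)
  have "complex_mat (A ^\<^sub>m N - 1\<^sub>m n) ^\<^sub>m k = complex_mat ((A ^\<^sub>m N - 1\<^sub>m n) ^\<^sub>m k)"
    using complex_mat_pow[of "A ^\<^sub>m N - 1\<^sub>m n" n k] AN by (simp add: minus_carrier_mat)
  also have "\<dots> = 0\<^sub>m n n"
    by (simp add: nil complex_mat_zero)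
  finally have "similar_mat_wit (0\<^sub>m n n) (mat_diag n (\<lambda>i. (d i ^ N - 1) ^ k)) P Q"
    using similar_mat_wit_pow[OF simM, of k] by (simp add: mat_diag_pow)
  then have "mat_diag n (\<lambda>i. (d i ^ N - 1) ^ k) = 0\<^sub>m n n"
    by (rule similar_mat_wit_zero[OF similar_mat_wit_sym])
  then have "mat_diag n (\<lambda>i. (d i ^ N - 1) ^ k) $$ (i, i) = 0" if "i < n" for i
    using that by simp
  then have "d i ^ N - 1 = 0" if "i < n" for i
    using that by (simp add: mat_diag_def)
  then have "mat_diag n (\<lambda>i. d i ^ N - 1) = 0\<^sub>m n n"
    by (intro eq_matI) (auto simp: mat_diag_def)
  then have "complex_mat (A ^\<^sub>m N - 1\<^sub>m n) = 0\<^sub>m n n"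
    using simM similar_mat_wit_zero by metis
  then have "complex_mat (A ^\<^sub>m N - 1\<^sub>m n) $$ (i, j) = 0" if "i < n" "j < n" for i j
    using that by simp
  then have "(A ^\<^sub>m N) $$ (i, j) = 1\<^sub>m n $$ (i, j)" if "i < n" "j < n" for i j
    using that AN by auto
  then show ?thesis
    using AN by (intro eq_matI) auto
qed

section \<open>Passage from integer to complex matrices and the normal unipotent core\<close>

lemma GL_I:
  assumes "A \<in> carrier_mat n n" "B \<in> carrier_mat n n" "A * B = 1\<^sub>m n" "B * A = 1\<^sub>m n"
  shows "A \<in> carrier (GL ty n)"
  using assms by (auto simp: GL_def units_of_def Units_def ring_mat_simps)

lemma GL_inv:
  fixes ty :: "'a::comm_ring_1 itself"
  assumes A: "A \<in> carrier (GL ty n)"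
  shows "A * inv\<^bsub>GL ty n\<^esub> A = 1\<^sub>m n" "inv\<^bsub>GL ty n\<^esub> A * A = 1\<^sub>m n"
proof -
  interpret G: group "GL ty n" using group_GL[where 'a='a and n=n] by (simp add: GL_def ring_mat_def)
  show "A * inv\<^bsub>GL ty n\<^esub> A = 1\<^sub>m n" "inv\<^bsub>GL ty n\<^esub> A * A = 1\<^sub>m n"
    using G.r_inv[OF A] G.l_inv[OF A] by (simp_all add: GL_simps)
qed

lemma group_hom_complex_mat: "group_hom (GL TYPE(int) n) (GL TYPE(complex) n) complex_mat"
proof (intro group_hom.intro group_GL group_hom_axioms.intro homI)
  fix x y assume x: "x \<in> carrier (GL TYPE(int) n)" and y: "y \<in> carrier (GL TYPE(int) n)"
  show "complex_mat (x \<otimes>\<^bsub>GL TYPE(int) n\<^esub> y) = complex_mat x \<otimes>\<^bsub>GL TYPE(complex) n\<^esub> complex_mat y"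
    using complex_mat_mult[OF GL_carrier_mat[OF x] GL_carrier_mat[OF y]] by (simp add: GL_simps)
next
  fix x assume "x \<in> carrier (GL TYPE(int) n)"
  then obtain y where xy: "x \<in> carrier_mat n n" "y \<in> carrier_mat n n" "x * y = 1\<^sub>m n" "y * x = 1\<^sub>m n"
    by (auto simp: GL_def units_of_def Units_def ring_mat_simps)
  show "complex_mat x \<in> carrier (GL TYPE(complex) n)"
  proof (rule GL_I)
    show "complex_mat x * complex_mat y = 1\<^sub>m n"
      using complex_mat_mult[OF xy(1,2)] xy(3) by (simp add: complex_mat_one)
    show "complex_mat y * complex_mat x = 1\<^sub>m n"
      using complex_mat_mult[OF xy(2,1)] xy(4) by (simp add: complex_mat_one)
  qed (use xy in simp_all)
qed

lemma (in group) conj_pow: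
  assumes "g \<in> carrier G" "x \<in> carrier G"
  shows "(g \<otimes> x \<otimes> inv g) [^] (k::nat) = g \<otimes> x [^] k \<otimes> inv g"
proof (induction k)
  case (Suc k)
  have "inv g \<otimes> (g \<otimes> (x \<otimes> inv g)) = x \<otimes> inv g"
    using assms by (simp add: m_assoc[symmetric])
  then show ?case using Suc assms by (simp add: m_assoc)
qed (use assms in simp)

text \<open>\<open>U\<close> is the intersection of the \<Gamma>-conjugates of the preimage in
  \<Gamma> of a unipotent finite index subgroup \<open>V\<close>, hence normalized by \<Gamma>. An
  exponent \<open>N\<close> for \<open>V\<close> serves for \<open>U\<close> as well, because it
  applies to all conjugates of \<gamma> at once.\<close>

lemma normal_unipotent_core:
  assumes \<Gamma>: "subgroup \<Gamma> (GL TYPE(int) n)" and vu: "virtually_unipotent n (complex_mat ` \<Gamma>)"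
  obtains U E and N :: nat where "unipotent_filtration n E U" "U \<subseteq> \<Gamma>" "N > 0"
    "\<And>\<gamma>. \<gamma> \<in> \<Gamma> \<Longrightarrow> \<gamma> [^]\<^bsub>GL TYPE(int) n\<^esub> N \<in> U"
    "\<And>\<gamma> u. \<gamma> \<in> \<Gamma> \<Longrightarrow> u \<in> U \<Longrightarrow> \<gamma> \<otimes>\<^bsub>GL TYPE(int) n\<^esub> u \<otimes>\<^bsub>GL TYPE(int) n\<^esub> inv\<^bsub>GL TYPE(int) n\<^esub> \<gamma> \<in> U"
proof -
  let ?G = "GL TYPE(int) n" and ?C = "GL TYPE(complex) n"
  interpret c: group_hom ?G ?C complex_mat by (rule group_hom_complex_mat)
  interpret \<Gamma>: subgroup \<Gamma> ?G by (rule \<Gamma>)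
  obtain V where V: "finite_index_subgroup V (?C\<lparr>carrier := complex_mat ` \<Gamma>\<rparr>)" "unipotent n V"
    and S: "subgroup (complex_mat ` \<Gamma>) ?C"
    using vu unfolding virtually_unipotent_def by blast
  then obtain P where P: "P \<in> carrier ?C"
    "\<And>A. A \<in> V \<Longrightarrow> P \<otimes>\<^bsub>?C\<^esub> A \<otimes>\<^bsub>?C\<^esub> inv\<^bsub>?C\<^esub> P \<in> unitriangular n"
    and V': "subgroup V ?C"
    unfolding unipotent_def by blast
  interpret V: subgroup V ?C by (rule V')
  have S_group: "group (?C\<lparr>carrier := complex_mat ` \<Gamma>\<rparr>)"
    by (rule subgroup.subgroup_is_group[OF S c.H.is_group])
  obtain N :: nat where N: "N > 0"
    and N_pow: "\<forall>x\<in>complex_mat ` \<Gamma>. x [^]\<^bsub>?C\<lparr>carrier := complex_mat ` \<Gamma>\<rparr>\<^esub> N \<in> V"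
    using group.exists_pow_mem_finite_index[OF S_group, of V] V(1)
    unfolding finite_index_subgroup_def by auto
  have powV: "complex_mat \<gamma> [^]\<^bsub>?C\<^esub> N \<in> V" if "\<gamma> \<in> \<Gamma>" for \<gamma>
    using N_pow that unfolding c.H.nat_pow_consistent[of _ N "complex_mat ` \<Gamma>"] by blast
  define conj where "conj \<delta> u = \<delta> \<otimes>\<^bsub>?G\<^esub> u \<otimes>\<^bsub>?G\<^esub> inv\<^bsub>?G\<^esub> \<delta>" for \<delta> u
  have conj_mult: "conj \<delta> (u \<otimes>\<^bsub>?G\<^esub> v) = conj \<delta> u \<otimes>\<^bsub>?G\<^esub> conj \<delta> v"
    if "\<delta> \<in> carrier ?G" "u \<in> carrier ?G" "v \<in> carrier ?G" for \<delta> u v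
  proof -
    have "inv\<^bsub>?G\<^esub> \<delta> \<otimes>\<^bsub>?G\<^esub> (\<delta> \<otimes>\<^bsub>?G\<^esub> (v \<otimes>\<^bsub>?G\<^esub> inv\<^bsub>?G\<^esub> \<delta>)) = v \<otimes>\<^bsub>?G\<^esub> inv\<^bsub>?G\<^esub> \<delta>"
      using that by (simp add: c.G.m_assoc[symmetric])
    then show ?thesis using that by (simp add: conj_def c.G.m_assoc)
  qed
  have conj_inv: "conj \<delta> (inv\<^bsub>?G\<^esub> u) = inv\<^bsub>?G\<^esub> (conj \<delta> u)"
    if "\<delta> \<in> carrier ?G" "u \<in> carrier ?G" for \<delta> u
    using that by (simp add: conj_def c.G.inv_mult_group c.G.m_assoc)
  have conj_conj: "conj \<delta> (conj \<gamma> u) = conj (\<delta> \<otimes>\<^bsub>?G\<^esub> \<gamma>) u"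
    if "\<delta> \<in> carrier ?G" "\<gamma> \<in> carrier ?G" "u \<in> carrier ?G" for \<delta> \<gamma> u
    using that by (simp add: conj_def c.G.inv_mult_group c.G.m_assoc)
  have conj_closed: "conj \<delta> u \<in> \<Gamma>" if "\<delta> \<in> \<Gamma>" "u \<in> \<Gamma>" for \<delta> u
    using that by (simp add: conj_def)
  define U where "U = {u \<in> \<Gamma>. \<forall>\<delta>\<in>\<Gamma>. complex_mat (conj \<delta> u) \<in> V}"
  have U\<Gamma>: "U \<subseteq> \<Gamma>" by (auto simp: U_def)
  have "subgroup U ?G"
  proof (rule c.G.subgroupI)
    show "U \<subseteq> carrier ?G" using U\<Gamma> \<Gamma>.subset by blast
  next
    have "\<one>\<^bsub>?G\<^esub> \<in> U" by (simp add: U_def conj_def)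
    then show "U \<noteq> {}" by blast
  next
    fix u assume "u \<in> U"
    then show "inv\<^bsub>?G\<^esub> u \<in> U" by (auto simp: U_def conj_inv conj_closed)
  next
    fix u v assume "u \<in> U" "v \<in> U"
    then show "u \<otimes>\<^bsub>?G\<^esub> v \<in> U" by (auto simp: U_def conj_mult conj_closed)
  qed
  moreover have "P * complex_mat u * inv\<^bsub>?C\<^esub> P \<in> unitriangular n" if "u \<in> U" for u
  proof -
    \<comment> \<open>The conjugating element 1 shows that \<open>U\<close> maps into
      \<open>V\<close>, so the matrix \<open>P\<close> that triangularizes \<open>V\<close> also
      triangularizes \<open>U\<close>.\<close>
    have "u \<in> carrier ?G" using that by (simp add: U_def)
    then have "conj \<one>\<^bsub>?G\<^esub> u = u" by (simp add: conj_def)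
    moreover have "complex_mat (conj \<one>\<^bsub>?G\<^esub> u) \<in> V" using that by (simp add: U_def)
    ultimately show ?thesis using P(2) by (simp add: GL_simps)
  qed
  ultimately have "unipotent_filtration n
      (\<lambda>k. {a \<in> carrier_mat n n. P * complex_mat a * inv\<^bsub>?C\<^esub> P \<in> upper_band n k}) U"
    using P(1) by (intro unipotent_filtration_conjugate GL_carrier_mat[of _ "TYPE(complex)"] GL_inv) auto
  moreover have "\<gamma> [^]\<^bsub>?G\<^esub> N \<in> U" if \<gamma>: "\<gamma> \<in> \<Gamma>" for \<gamma>
  proof -
    have "complex_mat (conj \<delta> (\<gamma> [^]\<^bsub>?G\<^esub> N)) \<in> V" if \<delta>: "\<delta> \<in> \<Gamma>" for \<delta>
    proof -
      have "conj \<delta> (\<gamma> [^]\<^bsub>?G\<^esub> N) = (conj \<delta> \<gamma>) [^]\<^bsub>?G\<^esub> N"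
        using \<gamma> \<delta> by (simp add: conj_def c.G.conj_pow)
      then show ?thesis
        using powV[OF conj_closed[OF \<delta> \<gamma>]] conj_closed[OF \<delta> \<gamma>] by (simp add: c.hom_nat_pow)
    qed
    moreover have "\<gamma> [^]\<^bsub>?G\<^esub> N \<in> \<Gamma>"
      using \<gamma> by (induction N) auto
    ultimately show ?thesis by (simp add: U_def)
  qed
  moreover have "\<gamma> \<otimes>\<^bsub>?G\<^esub> u \<otimes>\<^bsub>?G\<^esub> inv\<^bsub>?G\<^esub> \<gamma> \<in> U" if "\<gamma> \<in> \<Gamma>" "u \<in> U" for \<gamma> u
    unfolding conj_def[symmetric] using that by (auto simp: U_def conj_conj conj_closed)
  ultimately show ?thesis
    using that U\<Gamma> N by blast
qed

section \<open>Separation of the conjugacy class by a congruence neighbourhood of \<Gamma>\<close>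

theorem theorem1p1:
  fixes n :: nat and \<eta> :: "int mat" and \<Gamma> :: "int mat set"
  assumes "n \<ge> 1"
    and "\<eta> \<in> carrier (GL TYPE(int) n)"
    and "\<eta> \<noteq> \<one>\<^bsub>GL TYPE(int) n\<^esub>"
    and "semisimple \<eta>"
    and "subgroup \<Gamma> (GL TYPE(int) n)"
    and "torsion_free ((GL TYPE(int) n)\<lparr>carrier := \<Gamma>\<rparr>)"
    and "virtually_unipotent n (complex_mat ` \<Gamma>)"
  shows "\<exists>\<Lambda>\<^sub>0. finite_index_subgroup \<Lambda>\<^sub>0 (GL TYPE(int) n) \<and> \<Gamma> \<subseteq> \<Lambda>\<^sub>0
           \<and> conjugacy_class (GL TYPE(int) n) \<eta> \<inter> \<Lambda>\<^sub>0 = {}"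
proof -
  let ?G = "GL TYPE(int) n"
  interpret G: group ?G by (rule group_GL)
  interpret \<Gamma>: subgroup \<Gamma> ?G by (rule assms(5))
  obtain U E and N :: nat where UE: "unipotent_filtration n E U" and U\<Gamma>: "U \<subseteq> \<Gamma>" and N: "N > 0"
    and powU: "\<And>\<gamma>. \<gamma> \<in> \<Gamma> \<Longrightarrow> \<gamma> [^]\<^bsub>?G\<^esub> N \<in> U"
    and conjU: "\<And>\<gamma> u. \<gamma> \<in> \<Gamma> \<Longrightarrow> u \<in> U \<Longrightarrow> \<gamma> \<otimes>\<^bsub>?G\<^esub> u \<otimes>\<^bsub>?G\<^esub> inv\<^bsub>?G\<^esub> \<gamma> \<in> U"
    using normal_unipotent_core[OF assms(5,7)] by metis
  interpret unipotent_filtration n E U by (rule UE)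
  note eta = GL_carrier_mat[OF assms(2)]
  obtain m1 where m1: "m1 > 0" "\<And>u. u \<in> U \<Longrightarrow> mcong n m1 u (1\<^sub>m n) \<Longrightarrow> \<exists>w\<in>U. w [^]\<^bsub>?G\<^esub> N = u"
    using root_of_congruent_to_one[OF N] by blast
  \<comment> \<open>The moduli \<open>m2\<close> and \<open>m3\<close> are chosen for \<eta> itself;
    they serve all conjugates because congruences to zero are carried back to \<eta>. The outer
    exponent \<open>n\<close> is the one that annihilates \<open>u - 1\<close> for \<open>u\<close>
    in \<open>U\<close>.\<close>
  have carrier_m2: "(\<eta> ^\<^sub>m N - 1\<^sub>m n) ^\<^sub>m n \<in> carrier_mat n n"
    using eta by (simp add: minus_carrier_mat)
  obtain m2 where m2: "m2 > 0"
    "mcong n m2 ((\<eta> ^\<^sub>m N - 1\<^sub>m n) ^\<^sub>m n) (0\<^sub>m n n) \<Longrightarrow> (\<eta> ^\<^sub>m N - 1\<^sub>m n) ^\<^sub>m n = 0\<^sub>m n n"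
    using mcong_zero_imp_zero[OF carrier_m2] by blast
  have carrier_m3: "(\<eta> - 1\<^sub>m n) ^\<^sub>m n \<in> carrier_mat n n"
    using eta by (simp add: minus_carrier_mat)
  obtain m3 where m3: "m3 > 0"
    "mcong n m3 ((\<eta> - 1\<^sub>m n) ^\<^sub>m n) (0\<^sub>m n n) \<Longrightarrow> (\<eta> - 1\<^sub>m n) ^\<^sub>m n = 0\<^sub>m n n"
    using mcong_zero_imp_zero[OF carrier_m3] by blast
  define m where "m = m1 * m2 * m3"
  have m: "m > 0" "m1 dvd m" "m2 dvd m" "m3 dvd m"
    using m1(1) m2(1) m3(1) by (auto simp: m_def)
  define L where "L = {g \<in> carrier ?G. \<exists>\<gamma>\<in>\<Gamma>. mcong n m g \<gamma>}"
  have False if x: "x \<in> conjugacy_class ?G \<eta>" and xL: "x \<in> L" for x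
  proof -
    obtain h where h: "h \<in> carrier ?G" "x = h * \<eta> * inv\<^bsub>?G\<^esub> h"
      using x by (auto simp: conjugacy_class_def GL_simps)
    obtain \<gamma> where \<gamma>: "\<gamma> \<in> \<Gamma>" "mcong n m x \<gamma>" and xG: "x \<in> carrier ?G"
      using xL by (auto simp: L_def)
    note \<gamma>G = \<Gamma>.mem_carrier[OF \<gamma>(1)]
    note xm = GL_carrier_mat[OF xG]
    have sim: "similar_mat_wit x \<eta> h (inv\<^bsub>?G\<^esub> h)"
      using h eta xm GL_carrier_mat[OF h(1)] GL_carrier_mat[OF G.inv_closed[OF h(1)]]
      by (intro similar_mat_witI[of _ _ n] GL_inv) auto
    \<comment> \<open>If \<gamma>\<open>^j\<close> is in \<open>U\<close>, then
      (\<gamma>\<open>^j - 1)^n\<close> vanishes, so \<open>(x^j - 1)^n\<close> is congruent to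
      zero, and the integral matrix \<open>h\<close> conjugates it back to \<eta>. This serves for
      \<open>j = N\<close> and, once \<gamma> is known to be in \<open>U\<close>, for
      \<open>j = 1\<close>.\<close>
    have transfer: "mcong n m ((\<eta> ^\<^sub>m j - 1\<^sub>m n) ^\<^sub>m n) (0\<^sub>m n n)" if "\<gamma> ^\<^sub>m j \<in> U" for j
    proof (rule mcong_zero_similar)
      show "similar_mat_wit ((x ^\<^sub>m j - 1\<^sub>m n) ^\<^sub>m n) ((\<eta> ^\<^sub>m j - 1\<^sub>m n) ^\<^sub>m n) h (inv\<^bsub>?G\<^esub> h)"
        using xm by (intro similar_mat_wit_pow similar_mat_wit_minus_one sim) simp
      have "mcong n m ((x ^\<^sub>m j - 1\<^sub>m n) ^\<^sub>m n) ((\<gamma> ^\<^sub>m j - 1\<^sub>m n) ^\<^sub>m n)"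
        by (intro mcong_pow mcong_diff \<gamma>(2) mcong_refl one_carrier_mat)
      then show "mcong n m ((x ^\<^sub>m j - 1\<^sub>m n) ^\<^sub>m n) (0\<^sub>m n n)"
        by (simp add: pow_minus_one_top[OF that])
      then show "(x ^\<^sub>m j - 1\<^sub>m n) ^\<^sub>m n \<in> carrier_mat n n"
        by (simp add: mcong_def)
    qed
    have "\<gamma> ^\<^sub>m N \<in> U"
      using powU[OF \<gamma>(1)] by (simp add: GL_pow[OF \<gamma>G])
    from m2(2)[OF mcong_dvd[OF transfer[OF this] m(3)]] have "\<eta> ^\<^sub>m N = 1\<^sub>m n"
      by (rule semisimple_pow_eq_one[OF eta assms(4)])
    then have "x ^\<^sub>m N = 1\<^sub>m n"
      using similar_mat_wit_pow_id[OF sim, of N] GL_inv[OF h(1)] GL_carrier_mat[OF h(1)] by simp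
    then have "mcong n m (\<gamma> ^\<^sub>m N) (1\<^sub>m n)"
      using mcong_sym[OF mcong_pow[OF \<gamma>(2), of N]] by simp
    then obtain w where w: "w \<in> U" "w [^]\<^bsub>?G\<^esub> N = \<gamma> [^]\<^bsub>?G\<^esub> N"
      using m1(2)[OF powU[OF \<gamma>(1)]] m(2) mcong_dvd by (auto simp: GL_pow[OF \<gamma>G])
    have wG: "w \<in> carrier ?G" using w(1) U.mem_carrier by blast
    \<comment> \<open>The conjugate of \<open>w\<close> by \<gamma> is again an \<open>N\<close>-th
      root of \<gamma>\<open>^N\<close> in \<open>U\<close>, because \<gamma> commutes with its
      power and normalizes \<open>U\<close>. Uniqueness of roots then makes \<gamma> and
      \<open>w\<close> commute.\<close>
    have "(\<gamma> \<otimes>\<^bsub>?G\<^esub> w \<otimes>\<^bsub>?G\<^esub> inv\<^bsub>?G\<^esub> \<gamma>) [^]\<^bsub>?G\<^esub> N = w [^]\<^bsub>?G\<^esub> N"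
    proof -
      have "\<gamma> \<otimes>\<^bsub>?G\<^esub> \<gamma> [^]\<^bsub>?G\<^esub> N = \<gamma> [^]\<^bsub>?G\<^esub> N \<otimes>\<^bsub>?G\<^esub> \<gamma>"
        using G.nat_pow_comm[OF \<gamma>G, of 1 N] \<gamma>G by simp
      then have "\<gamma> \<otimes>\<^bsub>?G\<^esub> \<gamma> [^]\<^bsub>?G\<^esub> N \<otimes>\<^bsub>?G\<^esub> inv\<^bsub>?G\<^esub> \<gamma> = \<gamma> [^]\<^bsub>?G\<^esub> N"
        using \<gamma>G by (simp add: G.m_assoc)
      then show ?thesis
        unfolding G.conj_pow[OF \<gamma>G wG] w(2) .
    qed
    then have "\<gamma> \<otimes>\<^bsub>?G\<^esub> w \<otimes>\<^bsub>?G\<^esub> inv\<^bsub>?G\<^esub> \<gamma> = w"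
      by (rule root_unique[OF conjU[OF \<gamma>(1) w(1)] w(1) N])
    moreover have "\<gamma> \<otimes>\<^bsub>?G\<^esub> w = \<gamma> \<otimes>\<^bsub>?G\<^esub> w \<otimes>\<^bsub>?G\<^esub> inv\<^bsub>?G\<^esub> \<gamma> \<otimes>\<^bsub>?G\<^esub> \<gamma>"
      using \<gamma>G wG by (simp add: G.m_assoc)
    ultimately have comm: "\<gamma> \<otimes>\<^bsub>?G\<^esub> w = w \<otimes>\<^bsub>?G\<^esub> \<gamma>" by simp
    \<comment> \<open>As \<gamma> and \<open>w\<close> commute and have the same \<open>N\<close>-th
      power, \<open>t\<close> has trivial \<open>N\<close>-th power. Torsion freeness gives
      \<open>t = 1\<close>, so \<gamma> equals \<open>w\<close>.\<close>
    define t where "t = \<gamma> \<otimes>\<^bsub>?G\<^esub> inv\<^bsub>?G\<^esub> w"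
    have t\<Gamma>: "t \<in> \<Gamma>" using \<gamma>(1) w(1) U\<Gamma> by (auto simp: t_def)
    have "\<gamma> \<otimes>\<^bsub>?G\<^esub> inv\<^bsub>?G\<^esub> w = inv\<^bsub>?G\<^esub> w \<otimes>\<^bsub>?G\<^esub> \<gamma>"
    proof -
      have "inv\<^bsub>?G\<^esub> w \<otimes>\<^bsub>?G\<^esub> (w \<otimes>\<^bsub>?G\<^esub> \<gamma>) \<otimes>\<^bsub>?G\<^esub> inv\<^bsub>?G\<^esub> w = \<gamma> \<otimes>\<^bsub>?G\<^esub> inv\<^bsub>?G\<^esub> w"
        using \<gamma>G wG by (simp add: G.m_assoc[symmetric])
      moreover have "inv\<^bsub>?G\<^esub> w \<otimes>\<^bsub>?G\<^esub> (\<gamma> \<otimes>\<^bsub>?G\<^esub> w) \<otimes>\<^bsub>?G\<^esub> inv\<^bsub>?G\<^esub> w = inv\<^bsub>?G\<^esub> w \<otimes>\<^bsub>?G\<^esub> \<gamma>"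
        using \<gamma>G wG by (simp add: G.m_assoc)
      ultimately show ?thesis by (simp add: comm)
    qed
    then have "t [^]\<^bsub>?G\<^esub> N = \<gamma> [^]\<^bsub>?G\<^esub> N \<otimes>\<^bsub>?G\<^esub> (inv\<^bsub>?G\<^esub> w) [^]\<^bsub>?G\<^esub> N"
      unfolding t_def using \<gamma>G wG by (intro G.pow_mult_distrib) auto
    also have "\<dots> = \<one>\<^bsub>?G\<^esub>"
      using wG by (simp add: w(2)[symmetric] G.nat_pow_inv)
    finally have "t = \<one>\<^bsub>?G\<^esub>"
      using assms(6) N t\<Gamma> G.nat_pow_consistent[of t N \<Gamma>] unfolding torsion_free_def by auto
    moreover have "\<gamma> = t \<otimes>\<^bsub>?G\<^esub> w"
      using \<gamma>G wG by (simp add: t_def G.m_assoc)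
    ultimately have "\<gamma> = w" using wG by simp
    \<comment> \<open>Now the exponent 1 is available: the argument that gave
      \<eta>\<open>^N = 1\<close> gives \<eta>\<open>= 1\<close>, a contradiction.\<close>
    then have "\<gamma> ^\<^sub>m 1 \<in> U"
      using w(1) by simp
    from transfer[OF this] have "mcong n m ((\<eta> - 1\<^sub>m n) ^\<^sub>m n) (0\<^sub>m n n)"
      using eta by simp
    from m3(2)[OF mcong_dvd[OF this m(4)]] have "\<eta> ^\<^sub>m 1 = 1\<^sub>m n"
      using semisimple_pow_eq_one[OF eta assms(4), of 1 n] eta by simp
    then show False
      using assms(3) eta by (simp add: GL_simps)
  qed
  then have "conjugacy_class ?G \<eta> \<inter> L = {}" by blast
  moreover have "\<Gamma> \<subseteq> L"
  proof
    fix \<gamma> assume \<gamma>: "\<gamma> \<in> \<Gamma>"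
    then have "mcong n m \<gamma> \<gamma>"
      by (intro mcong_refl GL_carrier_mat[of _ "TYPE(int)"] \<Gamma>.mem_carrier)
    then show "\<gamma> \<in> L"
      using \<gamma> \<Gamma>.mem_carrier[OF \<gamma>] unfolding L_def by blast
  qed
  moreover have "finite_index_subgroup L ?G"
    unfolding L_def by (rule mcong_nhd_finite_index[OF assms(5) m(1)])
  ultimately show ?thesis by blast
qed

end
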